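(* Let $(V,\lhd,\rhd,\circ)$ be a pre-Gel'fand-Dorfman algebra over $\mathbb{C}$ such that $\lhd$ and $\rhd$ are not both identically zero, and let $R=\mathbb{C}[\partial]V$ be the corresponding quadratic left-symmetric conformal algebra. If $R$ is simple, then $(V,\lhd,\rhd,\circ)$ is simple.
   Context: All vector spaces are over $\mathbb{C}$. A left-symmetric algebra $(A,\circ)$ is a vector space with a bilinear product satisfying $(a\circ b)\circ c-a\circ(b\circ c)=(b\circ a)\circ c-b\circ(a\circ c)$. A left-symmetric conformal algebra is a $\mathbb{C}[\partial]$-module $R$ with a $\mathbb{C}$-bilinear map $R\times R\to R[\lambda]$, $(a,b)\mapsto a_\lambda b$, such that $\partial a_\lambda b=-\lambda a_\lambda b$, $a_\lambda\partial b=(\partial+\lambda)a_\lambda b$ (conformal sesquilinearity), and $(a_\lambda b)_{\lambda+\mu}c-a_\lambda(b_\mu c)=(b_\mu a)_{\lambda+\mu}c-b_\mu(a_\lambda c)$. An ideal of $R$ is a $\mathbb{C}[\partial]$-submodule $I$ with $I_\lambda R\subseteq I[\lambda]$ and $R_\lambda I\subseteq I[\lambda]$; it is proper if $I\neq 0,R$. $R$ is simple if it is non-trivial (its $\lambda$-product is not identically zero) and has no proper ideals. A pre-Novikov algebra $(A,\lhd,\rhd)$ is a vector space with two bilinear operations such that for all $a,b,c\in A$: $a\rhd(b\rhd c)=(a\rhd b+a\lhd b)\rhd c+b\rhd(a\rhd c)-(b\rhd a+b\lhd a)\rhd c$; $a\rhd(b\lhd c)=(a\rhd b)\lhd c+b\lhd(a\lhd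 c+a\rhd c)-(b\lhd a)\lhd c$; $(a\lhd b+a\rhd b)\rhd c=(a\rhd c)\lhd b$; $(a\lhd b)\lhd c=(a\lhd c)\lhd b$. A pre-Gel'fand-Dorfman algebra $(A,\lhd,\rhd,\circ)$ is a vector space such that $(A,\lhd,\rhd)$ is a pre-Novikov algebra, $(A,\circ)$ is a left-symmetric algebra, and for all $a,b,c$: $c\lhd(a\circ b-b\circ a)-a\circ(c\lhd b)-(b\circ c)\lhd a=-b\circ(c\lhd a)-(a\circ c)\lhd b$; $(a\circ b-b\circ a)\rhd c+(a\lhd b+a\rhd b)\circ c=a\rhd(b\circ c)-b\circ(a\rhd c)+(a\circ c)\lhd b$. A proper ideal of $(V,\lhd,\rhd,\circ)$ is a subspace $I\neq 0,V$ with $a\lhd b,\,b\lhd a,\,a\rhd b,\,b\rhd a,\,a\circ b,\,b\circ a\in I$ for all $a\in I$, $b\in V$. $(V,\lhd,\rhd,\circ)$ is simple if it is non-trivial (its operations are not all identically zero) and has no proper ideals. The quadratic left-symmetric conformal algebra corresponding to $(V,\lhd,\rhd,\circ)$ is the free $\mathbb{C}[\partial]$-module $R=\mathbb{C}[\partial]V=\mathbb{C}[\partial]\otimes V$ with $a_\lambda b=\partial(b\lhd a)+a\circ b+\lambda(a\rhd b+b\lhd a)$ for $a,b\in V$, extended by conformal sesquilinearity (this is a left-symmetric conformal algebra). *)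

theory Defs
  imports Complex_Main "HOL-Computational_Algebra.Polynomial"
begin

section \<open>Left-symmetric, pre-Novikov and pre-Gel'fand-Dorfman algebras\<close>

definition bilinear_op ::
    "(complex \<Rightarrow> 'v::ab_group_add \<Rightarrow> 'v) \<Rightarrow> ('v \<Rightarrow> 'v \<Rightarrow> 'v) \<Rightarrow> bool" where
  "bilinear_op scale f \<longleftrightarrow>
     (\<forall>a. Vector_Spaces.linear scale scale (\<lambda>b. f a b)) \<and>
     (\<forall>b. Vector_Spaces.linear scale scale (\<lambda>a. f a b))"

locale left_symmetric_algebra = vector_space scale
  for scale :: "complex \<Rightarrow> 'v::ab_group_add \<Rightarrow> 'v" +
  fixes circ :: "'v \<Rightarrow> 'v \<Rightarrow> 'v" (infixl "\<odot>" 70)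
  assumes bilinear_circ: "bilinear_op scale circ"
    and left_symmetric: "(a \<odot> b) \<odot> c - a \<odot> (b \<odot> c) = (b \<odot> a) \<odot> c - b \<odot> (a \<odot> c)"

locale pre_novikov_algebra = vector_space scale
  for scale :: "complex \<Rightarrow> 'v::ab_group_add \<Rightarrow> 'v" +
  fixes lhd :: "'v \<Rightarrow> 'v \<Rightarrow> 'v" (infixl "\<lhd>" 70)
    and rhd :: "'v \<Rightarrow> 'v \<Rightarrow> 'v" (infixl "\<rhd>" 70)
  assumes bilinear_lhd: "bilinear_op scale lhd"
    and bilinear_rhd: "bilinear_op scale rhd"
    and pre_novikov1:
      "a \<rhd> (b \<rhd> c) = (a \<rhd> b + a \<lhd> b) \<rhd> c + b \<rhd> (a \<rhd> c) - (b \<rhd> a + b \<lhd> a) \<rhd> c"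
    and pre_novikov2:
      "a \<rhd> (b \<lhd> c) = (a \<rhd> b) \<lhd> c + b \<lhd> (a \<lhd> c + a \<rhd> c) - (b \<lhd> a) \<lhd> c"
    and pre_novikov3: "(a \<lhd> b + a \<rhd> b) \<rhd> c = (a \<rhd> c) \<lhd> b"
    and pre_novikov4: "(a \<lhd> b) \<lhd> c = (a \<lhd> c) \<lhd> b"

locale pre_gelfand_dorfman_algebra =
  pre_novikov_algebra scale lhd rhd + left_symmetric_algebra scale circ
  for scale :: "complex \<Rightarrow> 'v::ab_group_add \<Rightarrow> 'v"
    and lhd :: "'v \<Rightarrow> 'v \<Rightarrow> 'v" (infixl "\<lhd>" 70)
    and rhd :: "'v \<Rightarrow> 'v \<Rightarrow> 'v" (infixl "\<rhd>" 70)
    and circ :: "'v \<Rightarrow> 'v \<Rightarrow> 'v" (infixl "\<odot>" 70) +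
  assumes pre_gelfand_dorfman1:
      "c \<lhd> (a \<odot> b - b \<odot> a) - a \<odot> (c \<lhd> b) - (b \<odot> c) \<lhd> a
         = - (b \<odot> (c \<lhd> a)) - (a \<odot> c) \<lhd> b"
    and pre_gelfand_dorfman2:
      "(a \<odot> b - b \<odot> a) \<rhd> c + (a \<lhd> b + a \<rhd> b) \<odot> c
         = a \<rhd> (b \<odot> c) - b \<odot> (a \<rhd> c) + (a \<odot> c) \<lhd> b"
begin

definition proper_ideal :: "'v set \<Rightarrow> bool" where
  "proper_ideal I \<longleftrightarrow>
     subspace I \<and> I \<noteq> {0} \<and> I \<noteq> UNIV \<and>
     (\<forall>a\<in>I. \<forall>b. a \<lhd> b \<in> I \<and> b \<lhd> a \<in> I \<and> a \<rhd> b \<in> I \<and> b \<rhd> a \<in> I \<and>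
                 a \<odot> b \<in> I \<and> b \<odot> a \<in> I)"

definition simple :: bool where
  "simple \<longleftrightarrow>
     \<not> ((\<forall>a b. a \<lhd> b = 0) \<and> (\<forall>a b. a \<rhd> b = 0) \<and> (\<forall>a b. a \<odot> b = 0)) \<and>
     (\<nexists>I. proper_ideal I)"

end


section \<open>Left-symmetric conformal algebras\<close>

text \<open>
  \<open>R[\<lambda>]\<close> is \<^typ>\<open>'r poly\<close>. Following the order in which the coefficients are nested,
  \<open>R[\<lambda>,\<mu>] = R[\<lambda>][\<mu>]\<close> is \<^typ>\<open>'r poly poly\<close> with \<open>\<mu>\<close> the outer variable.

  \<open>op_subst T f p\<close> is \<open>\<Sum>i. T\<^sup>i (f p\<^sub>i)\<close>: the coefficients of \<open>p = \<Sum>i. x\<^sup>i p\<^sub>i\<close> are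
  transformed by \<open>f\<close> and the variable \<open>x\<close> is replaced by the operator \<open>T\<close>.
\<close>

definition op_subst ::
    "('b \<Rightarrow> 'b) \<Rightarrow> ('a \<Rightarrow> 'b) \<Rightarrow> 'a::zero poly \<Rightarrow> 'b::comm_monoid_add" where
  "op_subst T f p = (\<Sum>i\<le>degree p. (T ^^ i) (f (coeff p i)))"

definition mult_lambda :: "'r::ab_group_add poly poly \<Rightarrow> 'r poly poly" where
  "mult_lambda = map_poly (pCons 0)"

definition mult_mu :: "'r::ab_group_add poly poly \<Rightarrow> 'r poly poly" where
  "mult_mu = pCons 0"

definition mult_lambda_mu :: "'r::ab_group_add poly poly \<Rightarrow> 'r poly poly" where
  "mult_lambda_mu p = mult_lambda p + mult_mu p"

text \<open>\<open>eval_at T p\<close> is \<open>p(\<lambda>)\<close>, \<open>p(\<mu>)\<close> or \<open>p(\<lambda>+\<mu>)\<close> in \<open>R[\<lambda>,\<mu>]\<close>, according to \<open>T\<close>.\<close>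

definition eval_at ::
    "('r poly poly \<Rightarrow> 'r poly poly) \<Rightarrow> 'r::ab_group_add poly \<Rightarrow> 'r poly poly" where
  "eval_at T = op_subst T (\<lambda>x. [:[:x:]:])"

text \<open>
  In \<open>left_symmetric\<close> the four terms are, in this order,
  \<open>(a\<^sub>\<lambda> b)\<^bsub>\<lambda>+\<mu>\<^esub> c\<close>, \<open>a\<^sub>\<lambda> (b\<^sub>\<mu> c)\<close>, \<open>(b\<^sub>\<mu> a)\<^bsub>\<lambda>+\<mu>\<^esub> c\<close> and \<open>b\<^sub>\<mu> (a\<^sub>\<lambda> c)\<close>. For example,
  if \<open>a\<^sub>\<lambda> b = \<Sum>i. \<lambda>\<^sup>i x\<^sub>i\<close>, then the first is \<open>\<Sum>i. \<lambda>\<^sup>i (x\<^sub>i)\<^bsub>\<lambda>+\<mu>\<^esub> c\<close>.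
\<close>

locale left_symmetric_conformal_algebra = module s
  for s :: "complex poly \<Rightarrow> 'r::ab_group_add \<Rightarrow> 'r" +
  fixes lprod :: "'r \<Rightarrow> 'r \<Rightarrow> 'r poly"
  assumes lprod_add_left: "lprod (a + a') b = lprod a b + lprod a' b"
    and lprod_add_right: "lprod a (b + b') = lprod a b + lprod a b'"
    and lprod_scale_left: "lprod (s [:k:] a) b = map_poly (s [:k:]) (lprod a b)"
    and lprod_scale_right: "lprod a (s [:k:] b) = map_poly (s [:k:]) (lprod a b)"
    and sesquilinear_left: "lprod (s [:0, 1:] a) b = - pCons 0 (lprod a b)"
    and sesquilinear_right:
      "lprod a (s [:0, 1:] b) = map_poly (s [:0, 1:]) (lprod a b) + pCons 0 (lprod a b)"
    and left_symmetric:
      "op_subst mult_lambda (\<lambda>x. eval_at mult_lambda_mu (lprod x c)) (lprod a b)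
       - op_subst mult_mu (\<lambda>y. eval_at mult_lambda (lprod a y)) (lprod b c)
       = op_subst mult_mu (\<lambda>x. eval_at mult_lambda_mu (lprod x c)) (lprod b a)
       - op_subst mult_lambda (\<lambda>y. eval_at mult_mu (lprod b y)) (lprod a c)"
begin

definition ideal :: "'r set \<Rightarrow> bool" where
  "ideal I \<longleftrightarrow>
     subspace I \<and>
     (\<forall>a\<in>I. \<forall>b. \<forall>n. coeff (lprod a b) n \<in> I \<and> coeff (lprod b a) n \<in> I)"

definition simple :: bool where
  "simple \<longleftrightarrow>
     \<not> (\<forall>a b. lprod a b = 0) \<and>
     (\<nexists>I. ideal I \<and> I \<noteq> {0} \<and> I \<noteq> UNIV)"

end


section \<open>The quadratic left-symmetric conformal algebra\<close>

text \<open>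
  The free module \<open>\<complex>[\<partial>] \<otimes> V = V[\<partial>]\<close> is \<^typ>\<open>'v poly\<close>, the variable being \<open>\<partial>\<close>; so \<open>V[\<partial>][\<lambda>]\<close>
  is \<^typ>\<open>'v poly poly\<close> with \<open>\<lambda>\<close> the outer variable.
\<close>

definition free_scale ::
    "(complex \<Rightarrow> 'v::ab_group_add \<Rightarrow> 'v) \<Rightarrow> complex poly \<Rightarrow> 'v poly \<Rightarrow> 'v poly" where
  "free_scale scale p x = op_subst (pCons 0) (\<lambda>k. map_poly (scale k) x) p"

text \<open>
  \<open>quadratic_gen\<close> is \<open>a\<^sub>\<lambda> b = \<partial>(b \<lhd> a) + a \<odot> b + \<lambda>(a \<rhd> b + b \<lhd> a)\<close> for \<open>a, b \<in> V\<close>, and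
  \<open>quadratic_prod\<close> is its sesquilinear extension
  \<open>(f(\<partial>)a)\<^sub>\<lambda> (g(\<partial>)b) = f(-\<lambda>) g(\<lambda>+\<partial>) (a\<^sub>\<lambda> b)\<close>.
  It makes the module given by \<open>free_scale scale\<close> a left-symmetric conformal algebra when the operations
  form a pre-Gel'fand-Dorfman algebra.
\<close>

definition quadratic_gen ::
    "('v \<Rightarrow> 'v \<Rightarrow> 'v) \<Rightarrow> ('v \<Rightarrow> 'v \<Rightarrow> 'v) \<Rightarrow> ('v \<Rightarrow> 'v \<Rightarrow> 'v) \<Rightarrow>
     'v \<Rightarrow> 'v \<Rightarrow> 'v::ab_group_add poly poly" where
  "quadratic_gen lhd rhd circ a b = [: [:circ a b, lhd b a:], [:rhd a b + lhd b a:] :]"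

definition quadratic_prod ::
    "('v \<Rightarrow> 'v \<Rightarrow> 'v) \<Rightarrow> ('v \<Rightarrow> 'v \<Rightarrow> 'v) \<Rightarrow> ('v \<Rightarrow> 'v \<Rightarrow> 'v) \<Rightarrow>
     'v poly \<Rightarrow> 'v poly \<Rightarrow> 'v::ab_group_add poly poly" where
  "quadratic_prod lhd rhd circ F G =
     op_subst (\<lambda>x. - pCons 0 x)
       (\<lambda>a. op_subst (\<lambda>x. pCons 0 x + map_poly (pCons 0) x) (quadratic_gen lhd rhd circ a) G) F"

end

theory Submission
  imports Defs
begin

text \<open>
  A proper ideal \<open>I\<close> of \<open>V\<close> generates the subset \<open>\<complex>[\<partial>]I\<close> of \<open>R = \<complex>[\<partial>]V\<close>, namely the polynomials
  in \<open>\<partial>\<close> all of whose coefficients lie in \<open>I\<close>. The coefficients of \<open>a\<^sub>\<lambda> b\<close> for \<open>a, b \<in> V\<close> are built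
  from \<open>b \<lhd> a\<close>, \<open>a \<odot> b\<close> and \<open>a \<rhd> b\<close>, which lie in \<open>I\<close> as soon as one of \<open>a\<close>, \<open>b\<close> does, and the
  sesquilinear extension only shifts, negates and adds such coefficients; so \<open>\<complex>[\<partial>]I\<close> is an ideal of \<open>R\<close>
  (\<open>ideal_coeffs_in\<close>). It meets the constants \<open>V\<close> exactly in \<open>I\<close>, and is therefore neither \<open>0\<close> nor \<open>R\<close>
  (\<open>proper_coeffs_in\<close>). Hence \<open>V\<close> has no proper ideals when \<open>R\<close> is simple, and \<open>V\<close> is non-trivial
  because \<open>\<lhd>\<close> or \<open>\<rhd>\<close> is non-zero.

  Ideals and simplicity are notions about a left-symmetric conformal algebra, so most of the work
  goes into showing that \<open>R\<close> is one (\<open>quadratic_conformal_algebra\<close>). The idea for left symmetry is that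
  the associator \<open>(a\<^sub>\<lambda> b)\<^bsub>\<lambda>+\<mu>\<^esub> c - a\<^sub>\<lambda> (b\<^sub>\<mu> c)\<close> of any sesquilinear product is itself sesquilinear: applying
  \<open>\<partial>\<close> to \<open>a\<close>, \<open>b\<close> or \<open>c\<close> multiplies it by \<open>-\<lambda>\<close>, \<open>-\<mu>\<close> or \<open>\<partial> + \<lambda> + \<mu>\<close> (\<open>associator_D\<close>). Exchanging \<open>a\<close>
  with \<open>b\<close> and \<open>\<lambda>\<close> with \<open>\<mu>\<close> respects these rules, so both sides of left symmetry agree on
  \<open>\<complex>[\<partial>]V\<close> once they agree on \<open>V\<close>. There the identity is an equality of polynomials of degree at most two in
  \<open>\<partial>, \<lambda>, \<mu>\<close>, and its ten coefficients are consequences of the axioms of a pre-Gel'fand-Dorfman algebra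
  (\<open>left_symmetric_on_generators\<close>).
\<close>


section \<open>Substitution of operators for variables\<close>

lemma additive_compose:
  assumes "Modules.additive f" "Modules.additive g"
  shows "Modules.additive (\<lambda>x. f (g x))"
  by unfold_locales (simp add: assms[THEN additive.add])

lemma additive_plus:
  assumes "Modules.additive f" "Modules.additive g"
  shows "Modules.additive (\<lambda>x. f x + g x)"
  by unfold_locales (simp add: assms[THEN additive.add])

lemma additive_uminus:
  assumes "Modules.additive f"
  shows "Modules.additive (\<lambda>x. - f x)"
  by unfold_locales (simp add: assms[THEN additive.add])

lemma additive_pCons_0: "Modules.additive (pCons (0::'a::ab_group_add))"
  by unfold_locales simp

lemma additive_map_poly:
  assumes "Modules.additive f"
  shows "Modules.additive (map_poly f)"
proof -
  interpret Modules.additive f by fact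
  show ?thesis
    by unfold_locales (simp add: poly_eq_iff coeff_map_poly zero add)
qed

lemma map_poly_pCons_additive:
  assumes "Modules.additive f"
  shows "map_poly f (pCons a p) = pCons (f a) (map_poly f p)"
  using additive.zero[OF assms] by (simp add: map_poly_pCons)

lemma map_poly_commute:
  assumes "Modules.additive f" "Modules.additive g" "\<And>x. f (g x) = g (f x)"
  shows "map_poly f (map_poly g p) = map_poly g (map_poly f p)"
  using additive.zero[OF assms(1)] additive.zero[OF assms(2)]
  by (simp add: poly_eq_iff coeff_map_poly assms(3))

lemma additive_funpow:
  fixes T :: "'a::ab_group_add \<Rightarrow> 'a"
  assumes "Modules.additive T"
  shows "Modules.additive (T ^^ i)"
proof
  show "(T ^^ i) (x + y) = (T ^^ i) x + (T ^^ i) y" for x y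
    by (induction i) (simp_all add: additive.add[OF assms])
qed

text \<open>
  Any bound \<open>n\<close> above the degree will do, so that the recursion on \<^const>\<open>pCons\<close> below
  needs no case distinction for \<open>p = 0\<close>.
\<close>

lemma op_subst_eq_sum:
  assumes "Modules.additive T" "f 0 = 0" "degree p \<le> n"
  shows "op_subst T f p = (\<Sum>i\<le>n. (T ^^ i) (f (coeff p i)))"
  unfolding op_subst_def using assms additive.zero[OF additive_funpow[OF assms(1)]]
  by (intro sum.mono_neutral_left) (auto simp: coeff_eq_0)

lemma op_subst_0:
  assumes "Modules.additive T" "Modules.additive f"
  shows "op_subst T f 0 = 0"
  by (simp add: op_subst_def additive.zero[OF assms(2)])

lemma op_subst_pCons:
  assumes "Modules.additive T" "Modules.additive f"
  shows "op_subst T f (pCons a p) = f a + T (op_subst T f p)"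
proof -
  have f0: "f 0 = 0" by (rule additive.zero[OF assms(2)])
  have "op_subst T f (pCons a p) = (\<Sum>i\<le>Suc (degree p). (T ^^ i) (f (coeff (pCons a p) i)))"
    using assms f0 by (intro op_subst_eq_sum) (simp_all add: degree_pCons_le)
  also have "\<dots> = f a + T (op_subst T f p)"
    by (simp add: sum.atMost_Suc_shift op_subst_def additive.sum[OF assms(1)] del: sum.atMost_Suc)
  finally show ?thesis .
qed

lemma additive_op_subst:
  assumes "Modules.additive T" "Modules.additive f"
  shows "Modules.additive (op_subst T f)"
proof
  fix p q
  show "op_subst T f (p + q) = op_subst T f p + op_subst T f q"
    by (induction p q rule: poly_induct2)
      (simp_all add: op_subst_0 op_subst_pCons assms additive.add[OF assms(1)] additive.add[OF assms(2)] algebra_simps)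
qed

lemma op_subst_map_poly:
  assumes "Modules.additive T" "Modules.additive f" "Modules.additive g"
  shows "op_subst T f (map_poly g p) = op_subst T (\<lambda>x. f (g x)) p"
proof -
  have "Modules.additive (\<lambda>x. f (g x))"
    by (rule additive_compose[OF assms(2,3)])
  then show ?thesis
    by (induction p) (simp_all add: op_subst_0 op_subst_pCons assms map_poly_pCons_additive)
qed

lemma op_subst_commute:
  assumes "Modules.additive T" "Modules.additive f" "Modules.additive S" "\<And>x. S (T x) = T (S x)"
  shows "S (op_subst T f p) = op_subst T (\<lambda>x. S (f x)) p"
proof -
  have "Modules.additive (\<lambda>x. S (f x))"
    by (rule additive_compose[OF assms(3,2)])
  then show ?thesis
    by (induction p)
      (simp_all add: op_subst_0 op_subst_pCons assms additive.zero[OF assms(3)] additive.add[OF assms(3)])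
qed

lemma op_subst_add_fun:
  assumes "Modules.additive T"
  shows "op_subst T (\<lambda>x. f x + g x) p = op_subst T f p + op_subst T g p"
  by (simp add: op_subst_def additive.add[OF additive_funpow[OF assms]] sum.distrib)

text \<open>Products are iterated substitutions, so this carries closure from generators to general elements.\<close>

lemma op_subst_in:
  assumes "0 \<in> S" "\<And>x y. x \<in> S \<Longrightarrow> y \<in> S \<Longrightarrow> x + y \<in> S" "\<And>x. x \<in> S \<Longrightarrow> T x \<in> S"
    and "\<And>i. f (coeff p i) \<in> S"
  shows "op_subst T f p \<in> S"
proof -
  have "(T ^^ i) x \<in> S" if "x \<in> S" for i x
    by (induction i) (simp_all add: assms(3) that)
  then have term_in: "(T ^^ i) (f (coeff p i)) \<in> S" for i
    using assms(4) .
  have "(\<Sum>i\<in>A. (T ^^ i) (f (coeff p i))) \<in> S" for A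
    by (induction A rule: infinite_finite_induct) (simp_all add: assms(1,2) term_in)
  then show ?thesis
    by (simp add: op_subst_def)
qed

lemma additive_coeff_const: "Modules.additive (\<lambda>x. [:[:x:]:])"
  by unfold_locales simp

lemma additive_eval_at: "Modules.additive T \<Longrightarrow> Modules.additive (eval_at T)"
  unfolding eval_at_def by (intro additive_op_subst additive_coeff_const)

lemma eval_at_pCons:
  "Modules.additive T \<Longrightarrow> eval_at T (pCons x p) = [:[:x:]:] + T (eval_at T p)"
  unfolding eval_at_def by (simp add: op_subst_pCons additive_coeff_const)

lemma eval_at_map_poly:
  assumes "Modules.additive T" "Modules.additive D"
    and "\<And>u. map_poly (map_poly D) (T u) = T (map_poly (map_poly D) u)"
  shows "eval_at T (map_poly D p) = map_poly (map_poly D) (eval_at T p)"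
  unfolding eval_at_def
  using assms
  by (simp add: op_subst_map_poly op_subst_commute additive_coeff_const additive_map_poly map_poly_pCons_additive)


section \<open>The associator of a sesquilinear product\<close>

locale sesquilinear_product =
  fixes D :: "'r::ab_group_add \<Rightarrow> 'r" and P :: "'r \<Rightarrow> 'r \<Rightarrow> 'r poly"
  assumes additive_D: "Modules.additive D"
    and additive_left: "Modules.additive (\<lambda>a. P a b)"
    and additive_right: "Modules.additive (P a)"
    and D_left: "P (D a) b = - pCons 0 (P a b)"
    and D_right: "P a (D b) = map_poly D (P a b) + pCons 0 (P a b)"

text \<open>
  The operators \<open>L\<close> and \<open>M\<close> stand for multiplication by \<open>\<lambda>\<close> and \<open>\<mu>\<close> in either order. Keeping them
  abstract lets one development serve both sides of left symmetry, which differ by exchanging the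
  two variables. The operator \<open>D\<close> acts on \<open>R[\<lambda>,\<mu>]\<close> coefficientwise.
\<close>

locale sesquilinear_product_in_variables = sesquilinear_product D P
  for D :: "'r::ab_group_add \<Rightarrow> 'r" and P :: "'r \<Rightarrow> 'r \<Rightarrow> 'r poly" +
  fixes L M :: "'r poly poly \<Rightarrow> 'r poly poly"
  assumes additive_L: "Modules.additive L"
    and additive_M: "Modules.additive M"
    and L_M: "L (M u) = M (L u)"
    and D_L: "map_poly (map_poly D) (L u) = L (map_poly (map_poly D) u)"
    and D_M: "map_poly (map_poly D) (M u) = M (map_poly (map_poly D) u)"
begin

abbreviation DD where "DD \<equiv> map_poly (map_poly D)"

definition LM where "LM u = L u + M u"

definition left_nested where
  "left_nested a b c = op_subst L (\<lambda>x. eval_at LM (P x c)) (P a b)"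

definition right_nested where
  "right_nested a b c = op_subst M (\<lambda>y. eval_at L (P a y)) (P b c)"

definition associator where
  "associator a b c = left_nested a b c - right_nested a b c"

lemma additive_LM: "Modules.additive LM"
  unfolding LM_def[abs_def] by (intro additive_plus additive_L additive_M)

lemma additive_DD: "Modules.additive DD"
  by (intro additive_map_poly additive_D)

lemma LM_L: "LM (L u) = L (LM u)"
  by (simp add: LM_def L_M additive.add[OF additive_L])

lemma D_LM: "DD (LM u) = LM (DD u)"
  by (simp add: LM_def additive.add[OF additive_DD] D_L D_M)

lemma additive_eval_left: "Modules.additive T \<Longrightarrow> Modules.additive (\<lambda>x. eval_at T (P x c))"
  by (rule additive_compose[OF additive_eval_at additive_left])

lemma additive_eval_right: "Modules.additive T \<Longrightarrow> Modules.additive (\<lambda>y. eval_at T (P a y))"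
  by (rule additive_compose[OF additive_eval_at additive_right])

lemma eval_left_D:
  assumes "Modules.additive T"
  shows "eval_at T (P (D x) c) = - T (eval_at T (P x c))"
  by (simp add: D_left additive.minus[OF additive_eval_at[OF assms]] eval_at_pCons[OF assms]
      additive.minus[OF assms])

lemma eval_right_D:
  assumes "Modules.additive T" "\<And>u. DD (T u) = T (DD u)"
  shows "eval_at T (P x (D c)) = DD (eval_at T (P x c)) + T (eval_at T (P x c))"
  by (simp add: D_right additive.add[OF additive_eval_at[OF assms(1)]] eval_at_pCons[OF assms(1)]
      eval_at_map_poly[OF assms(1) additive_D assms(2)])

lemma op_subst_pCons_0:
  assumes "Modules.additive T" "Modules.additive f"
  shows "op_subst T f (pCons 0 p) = T (op_subst T f p)"
  by (simp add: op_subst_pCons assms additive.zero[OF assms(2)])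

text \<open>
  For \<open>(a\<^sub>\<lambda> b)\<^bsub>\<lambda>+\<mu>\<^esub> c\<close> the middle rule is the subtle one: \<open>a\<^sub>\<lambda> \<partial>b = (\<partial> + \<lambda>) a\<^sub>\<lambda> b\<close>, and the outer product at
  \<open>\<lambda> + \<mu>\<close> turns this \<open>\<partial>\<close> into \<open>-(\<lambda> + \<mu>)\<close>, which leaves \<open>-\<mu>\<close>.
\<close>

lemma left_nested_D:
  "left_nested (D a) b c = - L (left_nested a b c)"
  "left_nested a (D b) c = - M (left_nested a b c)"
  "left_nested a b (D c) = DD (left_nested a b c) + LM (left_nested a b c)"
proof -
  let ?f = "\<lambda>x. eval_at LM (P x c)"
  note f = additive_eval_left[OF additive_LM, of c]
  note add = additive_op_subst[OF additive_L f]
  show "left_nested (D a) b c = - L (left_nested a b c)"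
    by (simp add: left_nested_def D_left additive.minus[OF add] op_subst_pCons_0
        additive.minus[OF additive_L] additive.minus[OF additive_M] additive_L f)
  have "op_subst L ?f (map_poly D (P a b)) = op_subst L (\<lambda>x. - LM (?f x)) (P a b)"
    by (simp add: op_subst_map_poly[OF additive_L f additive_D] eval_left_D additive_LM)
  also have "\<dots> = - LM (op_subst L ?f (P a b))"
    using op_subst_commute[OF additive_L f additive_uminus[OF additive_LM], of "P a b"]
    by (simp add: LM_L additive.minus[OF additive_L])
  finally show "left_nested a (D b) c = - M (left_nested a b c)"
    by (simp add: left_nested_def D_right additive.add[OF add] op_subst_pCons_0 additive_L f LM_def)
  show "left_nested a b (D c) = DD (left_nested a b c) + LM (left_nested a b c)"
    using op_subst_commute[OF additive_L f additive_plus[OF additive_DD additive_LM], of "P a b"]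
    by (simp add: left_nested_def eval_right_D additive_LM D_LM LM_L D_L additive.add[OF additive_L])
qed

lemma right_nested_D:
  "right_nested (D a) b c = - L (right_nested a b c)"
  "right_nested a (D b) c = - M (right_nested a b c)"
  "right_nested a b (D c) = DD (right_nested a b c) + LM (right_nested a b c)"
proof -
  let ?f = "\<lambda>y. eval_at L (P a y)"
  note f = additive_eval_right[OF additive_L, of a]
  note add = additive_op_subst[OF additive_M f]
  show "right_nested (D a) b c = - L (right_nested a b c)"
    using op_subst_commute[OF additive_M f additive_uminus[OF additive_L], of "P b c"]
    by (simp add: right_nested_def eval_left_D additive_L L_M additive.minus[OF additive_M])
  show "right_nested a (D b) c = - M (right_nested a b c)"
    by (simp add: right_nested_def D_left additive.minus[OF add] op_subst_pCons_0
        additive.minus[OF additive_L] additive.minus[OF additive_M] additive_M f)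
  have "op_subst M ?f (map_poly D (P b c)) = op_subst M (\<lambda>x. DD (?f x) + L (?f x)) (P b c)"
    by (simp add: op_subst_map_poly[OF additive_M f additive_D] eval_right_D additive_L D_L)
  also have "\<dots> = DD (op_subst M ?f (P b c)) + L (op_subst M ?f (P b c))"
    using op_subst_commute[OF additive_M f additive_plus[OF additive_DD additive_L], of "P b c"]
    by (simp add: L_M D_M additive.add[OF additive_M])
  finally show "right_nested a b (D c) = DD (right_nested a b c) + LM (right_nested a b c)"
    by (simp add: right_nested_def D_right additive.add[OF add] op_subst_pCons_0 additive_M f LM_def)
qed

text \<open>
  Both nested products obey the same three rules, so their difference does; this is what reduces left
  symmetry to generators of the \<open>\<complex>[\<partial>]\<close>-module.
\<close>

lemma associator_D:
  "associator (D a) b c = - L (associator a b c)"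
  "associator a (D b) c = - M (associator a b c)"
  "associator a b (D c) = DD (associator a b c) + LM (associator a b c)"
  by (simp_all add: associator_def left_nested_D right_nested_D additive.diff[OF additive_L]
      additive.diff[OF additive_M] additive.diff[OF additive_LM] additive.diff[OF additive_DD])

lemma additive_associator:
  "Modules.additive (\<lambda>a. associator a b c)"
  "Modules.additive (\<lambda>b. associator a b c)"
  "Modules.additive (\<lambda>c. associator a b c)"
  by (unfold_locales; simp add: associator_def left_nested_def right_nested_def op_subst_add_fun
      additive.add[OF additive_left] additive.add[OF additive_right]
      additive.add[OF additive_eval_at[OF additive_L]] additive.add[OF additive_eval_at[OF additive_LM]]
      additive.add[OF additive_op_subst[OF additive_L additive_eval_left[OF additive_LM]]]
      additive.add[OF additive_op_subst[OF additive_M additive_eval_right[OF additive_L]]]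
      additive_L additive_M)+

lemmas associator_add = additive_associator[THEN additive.add]

lemmas associator_0 = additive_associator[THEN additive.zero]

end

text \<open>Multiplication by \<open>\<lambda>\<close> and \<open>\<mu>\<close> are instances of the abstract operators, in both orders.\<close>

lemma additive_mult_lambda: "Modules.additive mult_lambda"
  unfolding mult_lambda_def by (intro additive_map_poly additive_pCons_0)

lemma additive_mult_mu: "Modules.additive mult_mu"
  unfolding mult_mu_def by (rule additive_pCons_0)

lemma mult_pCons:
  "mult_lambda (pCons p P) = pCons (pCons 0 p) (mult_lambda P)" "mult_lambda 0 = 0"
  "mult_mu P = pCons 0 P"
  "mult_lambda_mu P = mult_lambda P + mult_mu P"
  by (simp_all add: mult_lambda_def mult_mu_def mult_lambda_mu_def map_poly_pCons_additive additive_pCons_0)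

lemma variables_commute:
  fixes D :: "'r::ab_group_add \<Rightarrow> 'r"
  assumes "Modules.additive D"
  shows "mult_lambda (mult_mu u) = mult_mu (mult_lambda u)"
    and "map_poly (map_poly D) (mult_lambda u) = mult_lambda (map_poly (map_poly D) u)"
    and "map_poly (map_poly D) (mult_mu u) = mult_mu (map_poly (map_poly D) u)"
proof -
  show "mult_lambda (mult_mu u) = mult_mu (mult_lambda u)"
    by (simp add: mult_pCons)
  show "map_poly (map_poly D) (mult_lambda u) = mult_lambda (map_poly (map_poly D) u)"
    unfolding mult_lambda_def using assms
    by - (rule map_poly_commute[of "map_poly D" "pCons 0"],
      simp_all add: additive_map_poly additive_pCons_0 map_poly_pCons_additive additive.zero)
  show "map_poly (map_poly D) (mult_mu u) = mult_mu (map_poly (map_poly D) u)"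
    using assms by (simp add: mult_pCons additive_map_poly map_poly_pCons_additive)
qed

lemma (in sesquilinear_product) in_mult_variables:
  "sesquilinear_product_in_variables D P mult_lambda mult_mu"
  "sesquilinear_product_in_variables D P mult_mu mult_lambda"
  by unfold_locales
    (simp_all add: additive.add[OF additive_mult_lambda] additive.add[OF additive_mult_mu]
      variables_commute[OF additive_D])


section \<open>The quadratic product is sesquilinear\<close>

context pre_gelfand_dorfman_algebra
begin

lemma additive_ops:
  "Modules.additive (lhd a)" "Modules.additive (\<lambda>a. lhd a b)"
  "Modules.additive (rhd a)" "Modules.additive (\<lambda>a. rhd a b)"
  "Modules.additive (circ a)" "Modules.additive (\<lambda>a. circ a b)"
  using bilinear_lhd bilinear_rhd bilinear_circ
  by (auto simp: bilinear_op_def linear_iff_module_hom module_hom_iff intro!: additive.intro)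

lemmas ops_simps = additive_ops[THEN additive.add] additive_ops[THEN additive.diff]
  additive_ops[THEN additive.minus] additive_ops[THEN additive.zero]

lemma ops_scale:
  "lhd (scale k a) b = scale k (lhd a b)" "lhd a (scale k b) = scale k (lhd a b)"
  "rhd (scale k a) b = scale k (rhd a b)" "rhd a (scale k b) = scale k (rhd a b)"
  "circ (scale k a) b = scale k (circ a b)" "circ a (scale k b) = scale k (circ a b)"
  using bilinear_lhd bilinear_rhd bilinear_circ
  by (auto simp: bilinear_op_def linear_iff_module_hom module_hom_iff)

abbreviation gen :: "'v \<Rightarrow> 'v \<Rightarrow> 'v poly poly" where
  "gen \<equiv> quadratic_gen lhd rhd circ"

abbreviation Q :: "'v poly \<Rightarrow> 'v poly \<Rightarrow> 'v poly poly" where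
  "Q \<equiv> quadratic_prod lhd rhd circ"

text \<open>
  The operators substituted for \<open>\<partial>\<close> in the left and in the right factor. As opaque constants they keep
  the simplifier from moving the sign under \<^const>\<open>pCons\<close>, after which the rules for
  \<^const>\<open>op_subst\<close> would no longer match.
\<close>

definition neg_lambda :: "'v poly poly \<Rightarrow> 'v poly poly" where
  "neg_lambda x = - pCons 0 x"

definition lambda_plus_D :: "'v poly poly \<Rightarrow> 'v poly poly" where
  "lambda_plus_D x = pCons 0 x + map_poly (pCons 0) x"

text \<open>The product of a constant of \<open>V\<close> with a general element, so that \<open>Q\<close> is two single substitutions.\<close>

definition gen_times :: "'v \<Rightarrow> 'v poly \<Rightarrow> 'v poly poly" where
  "gen_times a G = op_subst lambda_plus_D (gen a) G"

lemma Q_gen_times: "Q F G = op_subst neg_lambda (\<lambda>a. gen_times a G) F"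
  by (simp add: quadratic_prod_def gen_times_def neg_lambda_def[abs_def] lambda_plus_D_def[abs_def])

lemma additive_neg_lambda: "Modules.additive neg_lambda"
  unfolding neg_lambda_def[abs_def] by (intro additive_uminus additive_pCons_0)

lemma additive_lambda_plus_D: "Modules.additive lambda_plus_D"
  unfolding lambda_plus_D_def[abs_def] by (intro additive_plus additive_map_poly additive_pCons_0)

lemma additive_gen: "Modules.additive (gen a)" "Modules.additive (\<lambda>a. gen a b)"
  by (unfold_locales; simp add: quadratic_gen_def ops_simps)+

lemma additive_gen_times: "Modules.additive (gen_times a)" "Modules.additive (\<lambda>a. gen_times a G)"
  unfolding gen_times_def[abs_def]
proof -
  show "Modules.additive (op_subst lambda_plus_D (gen a))"
    by (intro additive_op_subst additive_lambda_plus_D additive_gen)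
  have "gen (x + y) = (\<lambda>z. gen x z + gen y z)" for x y
    by (simp add: fun_eq_iff additive.add[OF additive_gen(2)])
  then show "Modules.additive (\<lambda>a. op_subst lambda_plus_D (gen a) G)"
    by unfold_locales (simp add: op_subst_add_fun[OF additive_lambda_plus_D])
qed

lemma gen_times_D: "gen_times a (pCons 0 G) = lambda_plus_D (gen_times a G)"
  unfolding gen_times_def
  by (simp add: op_subst_pCons additive_lambda_plus_D additive_gen additive_gen[THEN additive.zero])

lemma lambda_plus_D_neg_lambda: "lambda_plus_D (neg_lambda x) = neg_lambda (lambda_plus_D x)"
  by (simp add: neg_lambda_def lambda_plus_D_def
      additive.minus[OF additive_map_poly[OF additive_pCons_0]] map_poly_pCons_additive[OF additive_pCons_0])

lemma sesquilinear_Q: "sesquilinear_product (pCons 0) Q"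
proof (rule sesquilinear_product.intro)
  show "Modules.additive (pCons (0::'v))" by (rule additive_pCons_0)
  show "Modules.additive (\<lambda>F. Q F G)" for G
    unfolding Q_gen_times by (intro additive_op_subst additive_neg_lambda additive_gen_times)
  show "Modules.additive (Q F)" for F
    by unfold_locales
      (simp add: Q_gen_times additive.add[OF additive_gen_times(1)] op_subst_add_fun[OF additive_neg_lambda])
  show "Q (pCons 0 F) G = - pCons 0 (Q F G)" for F G
    by (simp add: Q_gen_times op_subst_pCons additive_neg_lambda additive_gen_times
        additive_gen_times[THEN additive.zero] neg_lambda_def)
  show "Q F (pCons 0 G) = map_poly (pCons 0) (Q F G) + pCons 0 (Q F G)" for F G
    using op_subst_commute[where S = lambda_plus_D and f = "\<lambda>a. gen_times a G",
        OF additive_neg_lambda additive_gen_times(2) additive_lambda_plus_D lambda_plus_D_neg_lambda, of F]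
    by (simp add: Q_gen_times gen_times_D lambda_plus_D_def add.commute)
qed


section \<open>Left symmetry of the quadratic product\<close>

lemma Q_const: "Q [:a:] [:b:] = gen a b"
  by (simp add: Q_gen_times gen_times_def op_subst_pCons op_subst_0 additive.zero[OF additive_neg_lambda]
      additive.zero[OF additive_lambda_plus_D] additive_neg_lambda additive_lambda_plus_D
      additive_gen_times additive_gen_times[THEN additive.zero] additive_gen additive_gen[THEN additive.zero])

lemma Q_pCons_left: "Q (pCons a F) G = Q [:a:] G - pCons 0 (Q F G)"
  using sesquilinear_product.D_left[OF sesquilinear_Q, of F G]
    additive.add[OF sesquilinear_product.additive_left[OF sesquilinear_Q], of "[:a:]" "pCons 0 F" G]
  by simp

lemma Q_pCons_right:
  "Q F (pCons b G) = Q F [:b:] + (map_poly (pCons 0) (Q F G) + pCons 0 (Q F G))"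
  using sesquilinear_product.D_right[OF sesquilinear_Q, of F G]
    additive.add[OF sesquilinear_product.additive_right[OF sesquilinear_Q], of F "[:b:]" "pCons 0 G"]
  by simp

lemma Q_0: "Q 0 G = 0" "Q F 0 = 0"
  using sesquilinear_Q additive.zero unfolding sesquilinear_product_def by blast+

text \<open>
  The patterns with a nested \<^const>\<open>pCons\<close> exclude constant polynomials, on which the
  recursions would rewrite a product to itself.
\<close>

lemmas Q_eval = Q_pCons_left[of _ "pCons _ _"] Q_pCons_right[of "[:_:]" _ "pCons _ _"] Q_const Q_0

text \<open>
  Both sides are evaluated to explicit polynomials in \<open>\<partial>, \<lambda>, \<mu>\<close> of total degree at most two, which are then
  compared coefficient by coefficient.
\<close>

lemma left_symmetric_on_generators:
  fixes a b c :: 'v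
  defines "A \<equiv> [:a:]" and "B \<equiv> [:b:]" and "C \<equiv> [:c:]"
  shows "op_subst mult_lambda (\<lambda>x. eval_at mult_lambda_mu (Q x C)) (Q A B)
       - op_subst mult_mu (\<lambda>y. eval_at mult_lambda (Q A y)) (Q B C)
       = op_subst mult_mu (\<lambda>x. eval_at mult_lambda_mu (Q x C)) (Q B A)
       - op_subst mult_lambda (\<lambda>y. eval_at mult_mu (Q B y)) (Q A C)"
proof -
  interpret lm: sesquilinear_product_in_variables "pCons 0" Q mult_lambda mult_mu
    by (rule sesquilinear_product.in_mult_variables[OF sesquilinear_Q])
  have lm: "mult_lambda_mu = lm.LM"
    by (simp add: fun_eq_iff lm.LM_def mult_lambda_mu_def)
  note add = additive_mult_lambda additive_mult_mu lm.additive_LM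
  note ev = add[THEN lm.additive_eval_left] add[THEN lm.additive_eval_right]
  note ev0 = ev[THEN additive.zero]
  note [simp] = quadratic_gen_def Q_eval op_subst_pCons op_subst_0 add ev ev0 eval_at_pCons mult_pCons
    additive_eval_at[THEN additive.zero]
  (* The axioms expanded by bilinearity and solved for one monomial. *)
  have novikov1: "a \<rhd> (b \<rhd> c) = (a \<rhd> b) \<rhd> c + (a \<lhd> b) \<rhd> c + b \<rhd> (a \<rhd> c)
      - (b \<rhd> a) \<rhd> c - (b \<lhd> a) \<rhd> c" for a b c
    using pre_novikov1[of a b c] by (simp add: ops_simps algebra_simps)
  have novikov2: "a \<rhd> (b \<lhd> c) = (a \<rhd> b) \<lhd> c + b \<lhd> (a \<lhd> c) + b \<lhd> (a \<rhd> c) - (b \<lhd> a) \<lhd> c" for a b c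
    using pre_novikov2[of a b c] by (simp add: ops_simps algebra_simps)
  have novikov3: "(a \<lhd> b) \<rhd> c = (a \<rhd> c) \<lhd> b - (a \<rhd> b) \<rhd> c" for a b c
    using pre_novikov3[of a b c] by (simp add: ops_simps algebra_simps)
  have gd1: "c \<lhd> (a \<odot> b) = c \<lhd> (b \<odot> a) + a \<odot> (c \<lhd> b) + (b \<odot> c) \<lhd> a
      - b \<odot> (c \<lhd> a) - (a \<odot> c) \<lhd> b"
    using pre_gelfand_dorfman1[of c a b] by (simp add: ops_simps algebra_simps)
  have gd2: "(a \<odot> b) \<rhd> c = (b \<odot> a) \<rhd> c - (a \<lhd> b) \<odot> c - (a \<rhd> b) \<odot> c
      + a \<rhd> (b \<odot> c) - b \<odot> (a \<rhd> c) + (a \<odot> c) \<lhd> b" for a b c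
    using pre_gelfand_dorfman2[of a b c] by (simp add: ops_simps algebra_simps)
  note novikov4 = pre_novikov4[of c b a]
  show ?thesis
    unfolding lm A_def B_def C_def
    apply (simp add: lm.LM_def map_poly_pCons_additive additive_pCons_0)
    apply (simp add: ops_simps)
    apply (intro conjI)
    (* The ten goals are the coefficients of 1, \<partial>, \<partial>^2, \<lambda>, \<lambda>\<partial>, \<lambda>^2, \<mu>, \<mu>\<partial>, \<lambda>\<mu>, \<mu>^2, in this order. *)
    subgoal by (rule left_symmetric)
    subgoal by (simp add: gd1 algebra_simps)
    subgoal by (rule novikov4)
    subgoal by (simp add: gd1 gd2[of a b c] algebra_simps)
    subgoal by (simp add: novikov2 novikov4 algebra_simps)
    subgoal by (simp add: novikov2 novikov3 novikov4 algebra_simps)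
    subgoal by (simp add: gd1 gd2[of b a c] algebra_simps)
    subgoal by (simp add: novikov2 novikov4 algebra_simps)
    subgoal using novikov1[of a b c] by (simp add: novikov2 novikov3 novikov4 algebra_simps)
    subgoal by (simp add: novikov2 novikov3 novikov4 algebra_simps)
    done
qed

text \<open>
  Left symmetry in full: both sides are additive and change in the same way under \<open>\<partial>\<close> in each argument,
  so induction on the polynomials \<open>H\<close>, \<open>G\<close>, \<open>F\<close> extends it from constants.
\<close>

lemma associator_commute:
  "sesquilinear_product_in_variables.associator Q mult_lambda mult_mu F G H =
   sesquilinear_product_in_variables.associator Q mult_mu mult_lambda G F H"
proof -
  interpret lm: sesquilinear_product_in_variables "pCons 0" Q mult_lambda mult_mu
    by (rule sesquilinear_product.in_mult_variables[OF sesquilinear_Q])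
  interpret ml: sesquilinear_product_in_variables "pCons 0" Q mult_mu mult_lambda
    by (rule sesquilinear_product.in_mult_variables[OF sesquilinear_Q])
  have LM: "mult_lambda_mu = lm.LM" "mult_lambda_mu = ml.LM"
    by (simp_all add: fun_eq_iff lm.LM_def ml.LM_def mult_lambda_mu_def add.commute)
  then have swap_LM: "ml.LM = lm.LM" by simp
  note associator_simps = lm.associator_0 ml.associator_0 lm.associator_add ml.associator_add
    lm.associator_D ml.associator_D
  have split: "pCons x p = [:x:] + pCons 0 p" for x :: 'v and p
    by simp
  have const: "lm.associator [:a:] [:b:] [:c:] = ml.associator [:b:] [:a:] [:c:]" for a b c
    using left_symmetric_on_generators[where a = a and b = b and c = c]
    unfolding lm.associator_def ml.associator_def lm.left_nested_def ml.left_nested_def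
      lm.right_nested_def ml.right_nested_def LM(1) swap_LM .
  have H: "lm.associator [:a:] [:b:] H = ml.associator [:b:] [:a:] H" for a b
  proof (induction H)
    case (pCons c H)
    then show ?case
      by (subst (1 2) split) (simp only: associator_simps const swap_LM)
  qed (simp only: associator_simps)
  have G: "lm.associator [:a:] G H = ml.associator G [:a:] H" for a
  proof (induction G)
    case (pCons b G)
    then show ?case
      by (subst (1 2) split) (simp only: associator_simps H)
  qed (simp only: associator_simps)
  show ?thesis
  proof (induction F)
    case (pCons a F)
    then show ?case
      by (subst (1 2) split) (simp only: associator_simps G)
  qed (simp only: associator_simps)
qed


section \<open>The quadratic left-symmetric conformal algebra\<close>

lemma additive_scale: "Modules.additive (scale k)" "Modules.additive (\<lambda>k. scale k v)"
  by (unfold_locales; simp add: scale_right_distrib scale_left_distrib)+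

lemma additive_map_scale:
  "Modules.additive (map_poly (scale k))" "Modules.additive (\<lambda>k. map_poly (scale k) x)"
  by (auto intro!: additive_map_poly additive_scale additive.intro
      simp: poly_eq_iff coeff_map_poly scale_left_distrib scale_right_distrib)

lemma free_scale_0: "free_scale scale 0 x = 0"
  by (simp add: free_scale_def op_subst_0 additive_pCons_0 additive_map_scale)

lemma free_scale_pCons:
  "free_scale scale (pCons k p) x = map_poly (scale k) x + pCons 0 (free_scale scale p x)"
  by (simp add: free_scale_def op_subst_pCons additive_pCons_0 additive_map_scale)

lemma map_scale_simps:
  "map_poly (scale 0) x = 0" "map_poly (scale 1) x = x"
  "map_poly (scale k) (map_poly (scale l) x) = map_poly (scale (k * l)) x"
  "map_poly (scale k) (pCons 0 x) = pCons 0 (map_poly (scale k) x)"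
  by (simp_all add: poly_eq_iff coeff_map_poly coeff_pCons split: nat.split)

lemma free_scale_const: "free_scale scale [:k:] x = map_poly (scale k) x"
  by (simp add: free_scale_pCons free_scale_0)

lemma free_scale_D: "free_scale scale [:0, 1:] x = pCons 0 x"
  by (simp add: free_scale_pCons free_scale_0 map_scale_simps)

lemma module_free_scale: "module (free_scale scale)"
proof
  show right: "free_scale scale p (x + y) = free_scale scale p x + free_scale scale p y" for p x y
    by (simp add: free_scale_def additive.add[OF additive_map_scale(1)] op_subst_add_fun additive_pCons_0)
  show left: "free_scale scale (p + q) x = free_scale scale p x + free_scale scale q x" for p q x
    unfolding free_scale_def
    by (rule additive.add[OF additive_op_subst[OF additive_pCons_0 additive_map_scale(2)]])
  have smult: "free_scale scale (smult k q) x = map_poly (scale k) (free_scale scale q x)" for k q x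
    by (induction q) (simp_all add: free_scale_0 free_scale_pCons additive.zero[OF additive_map_scale(1)]
        additive.add[OF additive_map_scale(1)] map_scale_simps)
  show "free_scale scale p (free_scale scale q x) = free_scale scale (p * q) x" for p q x
    by (induction p) (simp_all add: free_scale_0 free_scale_pCons left smult map_scale_simps)
  show "free_scale scale 1 x = x" for x
    by (simp add: one_pCons free_scale_const map_scale_simps)
qed

lemma gen_scale:
  "gen (scale k a) b = map_poly (map_poly (scale k)) (gen a b)"
  "gen a (scale k b) = map_poly (map_poly (scale k)) (gen a b)"
  by (simp_all add: quadratic_gen_def ops_scale scale_right_distrib map_poly_pCons_additive
      additive_map_scale additive_scale)

lemma map_scale_variables:
  fixes P :: "'v poly poly"
  shows "map_poly (map_poly (scale k)) (lambda_plus_D P) = lambda_plus_D (map_poly (map_poly (scale k)) P)"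
    and "map_poly (map_poly (scale k)) (neg_lambda P) = neg_lambda (map_poly (map_poly (scale k)) P)"
  by (simp_all add: lambda_plus_D_def neg_lambda_def poly_eq_iff coeff_map_poly coeff_pCons
      scale_right_distrib split: nat.split)

lemma gen_times_scale:
  "gen_times (scale k a) G = map_poly (map_poly (scale k)) (gen_times a G)"
  "gen_times a (map_poly (scale k) G) = map_poly (map_poly (scale k)) (gen_times a G)"
proof -
  have commute: "map_poly (map_poly (scale k)) (gen_times a G) =
      op_subst lambda_plus_D (\<lambda>b. map_poly (map_poly (scale k)) (gen a b)) G"
    unfolding gen_times_def
    by (intro op_subst_commute additive_lambda_plus_D additive_gen additive_map_poly
        additive_map_scale map_scale_variables)
  have "gen (scale k a) = (\<lambda>b. map_poly (map_poly (scale k)) (gen a b))"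
    by (simp add: fun_eq_iff gen_scale(1))
  then show "gen_times (scale k a) G = map_poly (map_poly (scale k)) (gen_times a G)"
    unfolding commute by (simp only: gen_times_def)
  show "gen_times a (map_poly (scale k) G) = map_poly (map_poly (scale k)) (gen_times a G)"
    unfolding commute
    by (simp only: gen_times_def gen_scale(2)
        op_subst_map_poly[OF additive_lambda_plus_D additive_gen(1) additive_scale(1)])
qed

lemma Q_scale:
  "Q (map_poly (scale k) F) G = map_poly (map_poly (scale k)) (Q F G)"
  "Q F (map_poly (scale k) G) = map_poly (map_poly (scale k)) (Q F G)"
proof -
  have commute: "map_poly (map_poly (scale k)) (Q F G) =
      op_subst neg_lambda (\<lambda>a. map_poly (map_poly (scale k)) (gen_times a G)) F"
    unfolding Q_gen_times
    by (intro op_subst_commute additive_neg_lambda additive_gen_times additive_map_poly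
        additive_map_scale map_scale_variables)
  show "Q (map_poly (scale k) F) G = map_poly (map_poly (scale k)) (Q F G)"
    unfolding commute
    by (simp only: Q_gen_times gen_times_scale(1)
        op_subst_map_poly[OF additive_neg_lambda additive_gen_times(2) additive_scale(1)])
  show "Q F (map_poly (scale k) G) = map_poly (map_poly (scale k)) (Q F G)"
    unfolding commute by (simp only: Q_gen_times gen_times_scale(2))
qed

lemma quadratic_conformal_algebra: "left_symmetric_conformal_algebra (free_scale scale) Q"
proof -
  interpret F: module "free_scale scale" by (rule module_free_scale)
  interpret sesquilinear_product "pCons 0" Q by (rule sesquilinear_Q)
  interpret lm: sesquilinear_product_in_variables "pCons 0" Q mult_lambda mult_mu
    by (rule in_mult_variables)
  interpret ml: sesquilinear_product_in_variables "pCons 0" Q mult_mu mult_lambda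
    by (rule in_mult_variables)
  have LM: "lm.LM = mult_lambda_mu" "ml.LM = mult_lambda_mu"
    by (simp_all add: fun_eq_iff lm.LM_def ml.LM_def mult_lambda_mu_def add.commute)
  have D_scale: "free_scale scale [:0, 1:] = pCons 0"
    by (simp add: fun_eq_iff free_scale_D)
  have const_scale: "free_scale scale [:k:] = map_poly (scale k)" for k
    by (simp add: fun_eq_iff free_scale_const)
  show ?thesis
  proof
    show "op_subst mult_lambda (\<lambda>x. eval_at mult_lambda_mu (Q x H)) (Q F G)
       - op_subst mult_mu (\<lambda>y. eval_at mult_lambda (Q F y)) (Q G H)
       = op_subst mult_mu (\<lambda>x. eval_at mult_lambda_mu (Q x H)) (Q G F)
       - op_subst mult_lambda (\<lambda>y. eval_at mult_mu (Q G y)) (Q F H)" for F G H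
      using associator_commute[of F G H]
      unfolding lm.associator_def ml.associator_def lm.left_nested_def ml.left_nested_def
        lm.right_nested_def ml.right_nested_def LM .
    show "Q (F + F') G = Q F G + Q F' G" for F F' G
      by (rule additive.add[OF additive_left])
    show "Q F (G + G') = Q F G + Q F G'" for F G G'
      by (rule additive.add[OF additive_right])
    show "Q (free_scale scale [:k:] F) G = map_poly (free_scale scale [:k:]) (Q F G)"
      "Q F (free_scale scale [:k:] G) = map_poly (free_scale scale [:k:]) (Q F G)" for k F G
      unfolding const_scale by (rule Q_scale)+
    show "Q (free_scale scale [:0, 1:] F) G = - pCons 0 (Q F G)" for F G
      unfolding D_scale by (rule D_left)
    show "Q F (free_scale scale [:0, 1:] G) =
        map_poly (free_scale scale [:0, 1:]) (Q F G) + pCons 0 (Q F G)" for F G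
      unfolding D_scale by (rule D_right)
  qed
qed


section \<open>Ideals generated by ideals of the coefficient algebra\<close>

definition coeffs_in :: "'v set \<Rightarrow> 'v poly set" where
  "coeffs_in I = {p. \<forall>n. coeff p n \<in> I}"

lemma coeffs_in_closed:
  assumes "subspace I"
  shows "0 \<in> coeffs_in I"
    and "p \<in> coeffs_in I \<Longrightarrow> q \<in> coeffs_in I \<Longrightarrow> p + q \<in> coeffs_in I"
    and "p \<in> coeffs_in I \<Longrightarrow> pCons 0 p \<in> coeffs_in I"
    and "p \<in> coeffs_in I \<Longrightarrow> map_poly (scale k) p \<in> coeffs_in I"
  using assms
  by (auto simp: coeffs_in_def coeff_map_poly coeff_pCons subspace_0 subspace_add subspace_scale
      split: nat.split)

lemma subspace_coeffs_in:
  assumes "subspace I"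
  shows "module.subspace (free_scale scale) (coeffs_in I)"
proof -
  interpret F: module "free_scale scale" by (rule module_free_scale)
  note closed = coeffs_in_closed[OF assms]
  show ?thesis
  proof (rule F.subspaceI)
    show "free_scale scale p x \<in> coeffs_in I" if "x \<in> coeffs_in I" for p x
      unfolding free_scale_def by (rule op_subst_in) (simp_all add: closed that)
  qed (simp_all add: closed)
qed

text \<open>
  The hypothesis speaks of pairs of coefficients and not of \<open>F\<close> or \<open>G\<close> lying in \<open>\<complex>[\<partial>]I\<close>; this way
  one statement serves both the left and the right ideal property.
\<close>

lemma coeff_Q_in:
  assumes "subspace I"
    and gen: "\<And>i j. [:circ (coeff F i) (coeff G j), lhd (coeff G j) (coeff F i):] \<in> coeffs_in I \<and>
       [:rhd (coeff F i) (coeff G j) + lhd (coeff G j) (coeff F i):] \<in> coeffs_in I"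
  shows "coeff (Q F G) n \<in> coeffs_in I"
proof -
  let ?S = "{P. \<forall>n. coeff P n \<in> coeffs_in I}"
  note closed = coeffs_in_closed[OF assms(1)]
  have neg: "- p \<in> coeffs_in I" if "p \<in> coeffs_in I" for p
    using that by (simp add: coeffs_in_def subspace_neg[OF assms(1)])
  have gen_in: "gen (coeff F i) (coeff G j) \<in> ?S" for i j
    using gen[of i j] closed(1) by (auto simp: quadratic_gen_def coeff_pCons split: nat.split)
  have zero: "0 \<in> ?S"
    by (simp add: closed)
  have add: "P + P' \<in> ?S" if "P \<in> ?S" "P' \<in> ?S" for P P'
    using that by (simp add: closed)
  have neg_lambda: "neg_lambda P \<in> ?S" if "P \<in> ?S" for P
    using that neg by (simp add: closed neg_lambda_def coeff_pCons split: nat.split)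
  have lambda_plus_D: "lambda_plus_D P \<in> ?S" if "P \<in> ?S" for P
    using that by (simp add: closed lambda_plus_D_def coeff_map_poly coeff_pCons split: nat.split)
  have "gen_times (coeff F i) G \<in> ?S" for i
    unfolding gen_times_def by (intro op_subst_in zero add lambda_plus_D gen_in)
  then have "Q F G \<in> ?S"
    unfolding Q_gen_times by (intro op_subst_in zero add neg_lambda)
  then show ?thesis by simp
qed

lemma ideal_coeffs_in:
  assumes "proper_ideal I"
  shows "left_symmetric_conformal_algebra.ideal (free_scale scale) Q (coeffs_in I)"
proof -
  have sub: "subspace I"
    and I: "\<And>a b. a \<in> I \<Longrightarrow> lhd a b \<in> I \<and> lhd b a \<in> I \<and> rhd a b \<in> I \<and> rhd b a \<in> I \<and>
      circ a b \<in> I \<and> circ b a \<in> I"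
    using assms by (auto simp: proper_ideal_def)
  have "coeff (Q F G) n \<in> coeffs_in I \<and> coeff (Q G F) n \<in> coeffs_in I" if "F \<in> coeffs_in I" for F G n
  proof -
    have coeff: "coeff F i \<in> I" for i
      using that by (simp add: coeffs_in_def)
    have const: "[:v:] \<in> coeffs_in I" if "v \<in> I" for v
      using that subspace_0[OF sub] by (simp add: coeffs_in_def coeff_pCons split: nat.split)
    have linear: "[:v, w:] \<in> coeffs_in I" if "v \<in> I" "w \<in> I" for v w
      using that subspace_0[OF sub] by (simp add: coeffs_in_def coeff_pCons split: nat.split)
    show ?thesis
      by (intro conjI coeff_Q_in sub const linear subspace_add[OF sub])
        (simp_all add: I[OF coeff])
  qed
  then show ?thesis
    using subspace_coeffs_in[OF sub]
    by (simp add: left_symmetric_conformal_algebra.ideal_def[OF quadratic_conformal_algebra])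
qed

text \<open>A constant polynomial lies in \<open>\<complex>[\<partial>]I\<close> exactly when its value lies in \<open>I\<close>.\<close>

lemma proper_coeffs_in:
  assumes "proper_ideal I"
  shows "coeffs_in I \<noteq> {0}" and "coeffs_in I \<noteq> UNIV"
proof -
  have "subspace I" "I \<noteq> {0}" "I \<noteq> UNIV"
    using assms by (auto simp: proper_ideal_def)
  moreover have const: "[:v:] \<in> coeffs_in I \<longleftrightarrow> v \<in> I" for v
    using subspace_0[OF \<open>subspace I\<close>]
    by (auto simp: coeffs_in_def coeff_pCons split: nat.split dest: spec[of _ 0])
  ultimately obtain v w where "v \<in> I" "v \<noteq> 0" "w \<notin> I"
    using subspace_0 by blast
  then have "[:v:] \<in> coeffs_in I" "[:v:] \<noteq> 0" "[:w:] \<notin> coeffs_in I"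
    by (simp_all add: const)
  then show "coeffs_in I \<noteq> {0}" "coeffs_in I \<noteq> UNIV"
    by blast+
qed

end


section \<open>Simplicity\<close>

theorem proposition4p2:
  fixes scale :: "complex \<Rightarrow> 'v::ab_group_add \<Rightarrow> 'v"
    and lhd rhd circ :: "'v \<Rightarrow> 'v \<Rightarrow> 'v"
  assumes "pre_gelfand_dorfman_algebra scale lhd rhd circ"
    and "\<not> ((\<forall>a b. lhd a b = 0) \<and> (\<forall>a b. rhd a b = 0))"
    and "left_symmetric_conformal_algebra.simple
           (free_scale scale) (quadratic_prod lhd rhd circ)"
  shows "pre_gelfand_dorfman_algebra.simple scale lhd rhd circ"
proof -
  interpret pre_gelfand_dorfman_algebra scale lhd rhd circ by fact
  interpret R: left_symmetric_conformal_algebra "free_scale scale" "quadratic_prod lhd rhd circ"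
    by (rule quadratic_conformal_algebra)
  have "\<not> proper_ideal I" for I
    using assms(3) ideal_coeffs_in[of I] proper_coeffs_in[of I] unfolding R.simple_def by blast
  then show ?thesis
    using assms(2) unfolding simple_def by blast
qed

end
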